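(* Let $G$ be a connected triangle-free graph of order $n$, size $m$ (number of edges), minimum degree $\delta$ and vertex-connectivity $\kappa$, and let $k$ be an integer with $\delta\geq k\geq 2$. If $$m \geq \delta^2+\left\lfloor\tfrac14 (n-2\delta+k-1)^2\right\rfloor,$$ then $\kappa\geq k$, unless $V(G)=X\cup S\cup Y$ (disjoint union) where $S$ is a minimum vertex-cut of $G$ with $G[S]=\overline{K_{k-1}}$ (i.e. $S$ is an independent set of $k-1$ vertices), $G[X\cup S]\cong K_{\delta, \delta}$ and $G[Y\cup S] \cong K_{\lceil(n-2\delta+k-1)/2\rceil,\lfloor(n-2\delta+k-1)/2\rfloor}$.
   Context: All graphs are finite, simple and undirected. A vertex-cut of a connected graph is a set of vertices whose removal disconnects it; the vertex-connectivity $\kappa(G)$ of a connected non-complete graph is the minimum size of a vertex-cut, and $\kappa(K_n)=n-1$; a minimum vertex-cut is one of size $\kappa(G)$. $G[Z]$ is the subgraph induced by $Z$, $\overline{K_r}$ is the edgeless graph on $r$ vertices, and $K_{a,b}$ is the complete bipartite graph. *)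

theory Defs
  imports Complex_Main "Graph_Theory.Kuratowski"
begin

text \<open>
  A finite simple undirected graph is a symmetric loop-free digraph without parallel arcs (locale
  \<^locale>\<open>graph\<close>), so an undirected edge is a pair of opposite arcs. The degree of a vertex is its
  out-degree, and the size has to count each such pair once. The predicate
  \<^const>\<open>complete_bipartite_digraph\<close> holds of exactly the graphs isomorphic to the complete
  bipartite graph with parts of the given sizes.
\<close>

definition graph_size :: "('a, 'b) pre_digraph \<Rightarrow> nat" where
  "graph_size G = card {{u, v} | u v. u \<rightarrow>\<^bsub>G\<^esub> v}"

definition min_degree :: "('a, 'b) pre_digraph \<Rightarrow> nat" where
  "min_degree G = Min (out_degree G ` verts G)"

definition triangle_free :: "('a, 'b) pre_digraph \<Rightarrow> bool" where
  "triangle_free G \<longleftrightarrow> \<not> (\<exists>u v w. u \<rightarrow>\<^bsub>G\<^esub> v \<and> v \<rightarrow>\<^bsub>G\<^esub> w \<and> w \<rightarrow>\<^bsub>G\<^esub> u)"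

definition edgeless_graph :: "nat \<Rightarrow> ('a, 'b) pre_digraph \<Rightarrow> bool" where
  "edgeless_graph r G \<longleftrightarrow> graph G \<and> card (verts G) = r \<and> arcs G = {}"

text \<open>
  The inclusion is proper because \<^const>\<open>Digraph_Component.connected\<close> fails for the graph
  without vertices: deleting all vertices does not count as disconnecting.
\<close>
definition vertex_cut :: "('a, 'b) pre_digraph \<Rightarrow> 'a set \<Rightarrow> bool" where
  "vertex_cut G S \<longleftrightarrow> S \<subset> verts G \<and> \<not> Digraph_Component.connected (G \<restriction> (verts G - S))"

definition vertex_connectivity :: "('a, 'b) pre_digraph \<Rightarrow> nat" where
  "vertex_connectivity G =
     (if K\<^bsub>card (verts G)\<^esub> G then card (verts G) - 1
      else Min (card ` {S. vertex_cut G S}))"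

definition min_vertex_cut :: "('a, 'b) pre_digraph \<Rightarrow> 'a set \<Rightarrow> bool" where
  "min_vertex_cut G S \<longleftrightarrow> vertex_cut G S \<and> card S = vertex_connectivity G"

end

theory Submission
  imports Defs
begin

text \<open>
  Let \<open>S\<close> be a minimum vertex-cut with fewer than \<open>k\<close> vertices, separating \<open>X\<close> from \<open>Y\<close>.
  Both \<open>X \<union> S\<close> and \<open>Y \<union> S\<close> have at least \<open>2 * \<delta>\<close> vertices, and Mantel's theorem bounds the number
  of edges that each of them spans. Since \<open>N \<mapsto> \<lfloor>N\<^sup>2 / 4\<rfloor>\<close> is convex, the sum of the two bounds is largest
  when \<open>card S = k - 1\<close> and one of the two sets has exactly \<open>2 * \<delta>\<close> vertices, and it then equals the
  assumed number of edges. Hence \<open>S\<close> is independent (its edges are counted twice) and both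
  pieces are extremal in Mantel's theorem, i.e. balanced complete bipartite graphs.
\<close>

section \<open>Arithmetic of the quarter-square \<open>N^2 div 4\<close>\<close>

lemma mult_le_quarter_square:
  fixes x y :: nat
  shows "x * y \<le> (x + y)\<^sup>2 div 4"
proof -
  have "4 * (x * y) \<le> (x + y)\<^sup>2"
  proof (cases "x \<le> y")
    case True
    then obtain d where "y = x + d" using le_Suc_ex by blast
    then show ?thesis by (simp add: power2_eq_square algebra_simps)
  next
    case False
    then obtain d where "x = y + d" using le_Suc_ex[of y x] by auto
    then show ?thesis by (simp add: power2_eq_square algebra_simps)
  qed
  then show ?thesis by linarith
qed

text \<open>With \<open>x = y + d\<close>, the square of the sum exceeds \<open>4 * (x * y)\<close>
  by \<open>d * d\<close>. Rounding down hides an excess below 4 only, so \<open>d\<close> is 0 or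
  1.\<close>

lemma mult_eq_quarter_squareD:
  fixes x y :: nat
  assumes "x * y = (x + y)\<^sup>2 div 4" "y \<le> x"
  shows "x = (x + y + 1) div 2" "y = (x + y) div 2"
proof -
  obtain d where d: "x = y + d" using assms(2) le_Suc_ex by blast
  have "(x + y)\<^sup>2 = 4 * (x * y) + d * d"
    by (simp add: d power2_eq_square algebra_simps)
  then have "d * d < 4" using assms(1) by linarith
  then have "d < 2" using mult_le_mono[of 2 d 2 d] by linarith
  then show "x = (x + y + 1) div 2" "y = (x + y) div 2" using d by linarith+
qed

lemma quarter_square_mono: "M \<le> N \<Longrightarrow> M\<^sup>2 div 4 \<le> (N :: nat)\<^sup>2 div 4"
  by (simp add: div_le_mono power_mono)

text \<open>Positivity of \<open>M\<close> excludes the only plateau: 0 and 1 both have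
  quarter-square 0.\<close>

lemma quarter_square_strict_mono:
  fixes M N :: nat
  assumes "0 < M" "M < N"
  shows "M\<^sup>2 div 4 < N\<^sup>2 div 4"
proof -
  have "M\<^sup>2 div 4 < (M + 1)\<^sup>2 div 4"
  \<comment> \<open>Consecutive squares differ by \<open>2 * M + 1\<close>, which is at least 4 only
    from \<open>M = 2\<close> on.\<close>
  proof (cases "M = 1")
    case False
    then have "M\<^sup>2 + 4 \<le> (M + 1)\<^sup>2"
      using assms(1) by (simp add: power2_eq_square)
    then show ?thesis by linarith
  qed (simp add: power2_eq_square)
  also have "\<dots> \<le> N\<^sup>2 div 4" using assms(2) by (intro quarter_square_mono) simp
  finally show ?thesis .
qed

text \<open>The cross term \<open>2 * (p * q)\<close> is at least 4 and so outweighs the rounding,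
  except for \<open>p = q = 1\<close>, where the values are 0 and 1.\<close>

lemma quarter_square_add_less:
  fixes p q :: nat
  assumes "0 < p" "0 < q"
  shows "p\<^sup>2 div 4 + q\<^sup>2 div 4 < (p + q)\<^sup>2 div 4"
proof (cases "p = 1 \<and> q = 1")
  case False
  have "2 \<le> p * q"
  proof (cases "p = 1")
    case True
    then show ?thesis using False assms by simp
  next
    case False
    then show ?thesis using mult_le_mono[of 2 p 1 q] assms by simp
  qed
  moreover have "(p + q)\<^sup>2 = p\<^sup>2 + q\<^sup>2 + 2 * (p * q)"
    by (simp add: power2_eq_square algebra_simps)
  ultimately have "p\<^sup>2 + q\<^sup>2 + 4 \<le> (p + q)\<^sup>2" by linarith
  then show ?thesis by linarith
qed (simp add: power2_eq_square)

lemma quarter_square_shift: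
  fixes d p :: nat
  shows "(2 * d + p)\<^sup>2 div 4 = d\<^sup>2 + d * p + p\<^sup>2 div 4"
proof -
  have "(2 * d + p)\<^sup>2 = p\<^sup>2 + 4 * (d\<^sup>2 + d * p)"
    by (simp add: power2_eq_square algebra_simps)
  then show ?thesis by simp
qed

lemma quarter_square_convex:
  fixes a b d N :: nat
  assumes "0 < d" "2 * d \<le> a" "2 * d \<le> b" "a + b \<le> N + 2 * d"
  shows "a\<^sup>2 div 4 + b\<^sup>2 div 4 \<le> d\<^sup>2 + N\<^sup>2 div 4"
    and "a\<^sup>2 div 4 + b\<^sup>2 div 4 = d\<^sup>2 + N\<^sup>2 div 4
      \<Longrightarrow> a + b = N + 2 * d \<and> (a = 2 * d \<or> b = 2 * d)"
proof -
  obtain p where a: "a = 2 * d + p" using assms(2) le_Suc_ex by blast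
  obtain q where b: "b = 2 * d + q" using assms(3) le_Suc_ex by blast
  \<comment> \<open>The size of one set after the other has been shrunk to \<open>2 * d\<close> and
    all excess moved over. In \<open>eq\<close> the terms linear in \<open>p\<close> and
    \<open>q\<close> cancel, so the gain is exactly the superadditivity defect of the
    quarter-square.\<close>
  define M where "M = 2 * d + (p + q)"
  have MN: "M \<le> N" using assms(4) a b by (simp add: M_def)
  have eq: "d\<^sup>2 + M\<^sup>2 div 4 + p\<^sup>2 div 4 + q\<^sup>2 div 4
      = a\<^sup>2 div 4 + b\<^sup>2 div 4 + (p + q)\<^sup>2 div 4"
    unfolding a b M_def quarter_square_shift by (simp add: algebra_simps)
  have pq: "p\<^sup>2 div 4 + q\<^sup>2 div 4 \<le> (p + q)\<^sup>2 div 4"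
    using quarter_square_add_less[of p q] by (cases "p = 0"; cases "q = 0") auto
  have mono: "M\<^sup>2 div 4 \<le> N\<^sup>2 div 4" by (rule quarter_square_mono) (rule MN)
  show "a\<^sup>2 div 4 + b\<^sup>2 div 4 \<le> d\<^sup>2 + N\<^sup>2 div 4"
    using eq pq mono by linarith
  assume tight: "a\<^sup>2 div 4 + b\<^sup>2 div 4 = d\<^sup>2 + N\<^sup>2 div 4"
  have "\<not> M < N"
    using quarter_square_strict_mono[of M N] assms(1) tight eq pq by (auto simp: M_def)
  moreover have "p = 0 \<or> q = 0"
    using quarter_square_add_less[of p q] tight eq mono by linarith
  ultimately show "a + b = N + 2 * d \<and> (a = 2 * d \<or> b = 2 * d)"
    using MN a b by (auto simp: M_def)
qed

section \<open>Arcs, edges and degrees\<close>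

lemma card_edges_of_sym:
  assumes fin: "finite E" and "sym E" and "irrefl E"
  shows "card E = 2 * card {{u, v} | u v. (u, v) \<in> E}"
proof -
  let ?g = "\<lambda>(u, v). {u, v}"
  have img: "?g ` E = {{u, v} | u v. (u, v) \<in> E}" by auto
  have fibre: "card {e \<in> E. ?g e = y} = 2" if y: "y \<in> ?g ` E" for y
  proof -
    from y obtain u v where uv: "(u, v) \<in> E" "y = {u, v}" by auto
    then have "u \<noteq> v" "(v, u) \<in> E"
      using \<open>irrefl E\<close> \<open>sym E\<close> by (auto simp: irrefl_def dest: symD)
    then have "{e \<in> E. ?g e = y} = {(u, v), (v, u)}"
      using uv by (auto simp: doubleton_eq_iff)
    then show ?thesis using \<open>u \<noteq> v\<close> by simp
  qed
  have "card E = (\<Sum>y \<in> ?g ` E. card {e \<in> E. ?g e = y})"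
    using sum.image_gen[OF fin, of "\<lambda>_. 1::nat" ?g] by simp
  also have "\<dots> = 2 * card (?g ` E)" using fibre by simp
  finally show ?thesis by (simp only: img)
qed

lemma (in graph) finite_arcs_ends: "finite (arcs_ends G)"
  by (simp add: arcs_ends_def)

text \<open>Translates the size into a number of ordered pairs; all later counting is done with
  \<open>arcs_ends\<close>, which explains the factors 2.\<close>

lemma (in graph) card_arcs_ends: "card (arcs_ends G) = 2 * graph_size G"
proof -
  have "sym (arcs_ends G)" "irrefl (arcs_ends G)"
    using sym_arcs by (auto simp: symmetric_def irrefl_def dest: adj_not_same)
  then show ?thesis
    unfolding graph_size_def by (intro card_edges_of_sym finite_arcs_ends)
qed

lemma (in graph) out_degree_eq_card_neighbours: "out_degree G v = card {w. v \<rightarrow> w}"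
proof -
  have "bij_betw (head G) (out_arcs G v) {w. v \<rightarrow> w}"
    unfolding bij_betw_def inj_on_def
    by (auto simp: arcs_ends_conv arc_to_ends_def intro!: no_multi_arcs)
  then show ?thesis unfolding out_degree_def by (rule bij_betw_same_card)
qed

lemma (in graph) finite_neighbours: "finite {w. v \<rightarrow> w}"
  by (rule finite_subset[OF _ finite_verts]) (auto dest: adj_in_verts)

section \<open>Induced subgraphs\<close>

lemma arcs_ends_induce_subgraph: "arcs_ends (G \<restriction> U) = arcs_ends G \<inter> U \<times> U"
  by (auto simp: arcs_ends_conv)

lemma triangle_free_induce_subgraph: "triangle_free G \<Longrightarrow> triangle_free (G \<restriction> U)"
  unfolding triangle_free_def arcs_ends_induce_subgraph by blast

lemma (in graph) graph_induce_subgraph: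
  assumes "U \<subseteq> verts G"
  shows "graph (G \<restriction> U)"
proof -
  interpret H: wf_digraph "G \<restriction> U" by (rule wellformed_induce_subgraph)
  have "symmetric (G \<restriction> U)"
    using sym_arcs by (auto simp: symmetric_def arcs_ends_induce_subgraph sym_def)
  moreover have "finite U" using assms finite_verts finite_subset by blast
  ultimately show ?thesis
    by unfold_locales
      (auto simp: no_loops intro!: no_multi_arcs)
qed

section \<open>Mantel's theorem with its equality case\<close>

text \<open>
  The parts are the neighbourhood \<open>A\<close> of a vertex of maximum degree and its complement \<open>B\<close>:
  \<open>A\<close> is independent, so all arcs meet \<open>B\<close>, whose vertices have degree at most \<open>card A\<close>.
\<close>
lemma (in graph) triangle_free_bipartition:
  assumes tf: "triangle_free G"
  obtains A B where "verts G = A \<union> B" "A \<inter> B = {}"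
    "card (arcs_ends G) \<le> 2 * (card A * card B)"
    "card (arcs_ends G) = 2 * (card A * card B) \<Longrightarrow> arcs_ends G = A \<times> B \<union> B \<times> A"
proof (cases "verts G = {}")
  case True
  then have "arcs_ends G = {}" by (auto dest: adj_in_verts)
  then show ?thesis using that[of "{}" "{}"] True by simp
next
  case False
  let ?E = "arcs_ends G"
  define deg where "deg v = card {w. v \<rightarrow> w}" for v
  have "Max (deg ` verts G) \<in> deg ` verts G" using False by (intro Max_in) auto
  then obtain v where v: "v \<in> verts G" and vmax: "deg v = Max (deg ` verts G)" by auto
  have deg_le: "deg u \<le> deg v" if "u \<in> verts G" for u
    unfolding vmax using that by (intro Max_ge) auto
  define A where "A = {w. v \<rightarrow> w}"
  define B where "B = verts G - A"
  have AV: "A \<subseteq> verts G" by (auto simp: A_def dest: adj_in_verts)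
  have part: "verts G = A \<union> B" "A \<inter> B = {}" using AV by (auto simp: B_def)
  have fin: "finite A" "finite B" using AV finite_subset[OF AV finite_verts] by (auto simp: B_def)
  have sym: "y \<rightarrow> x" if "x \<rightarrow> y" for x y using that by (rule graph_symmetric)
  \<comment> \<open>Two adjacent neighbours of \<open>v\<close> would form a triangle with
    it.\<close>
  have indep: "?E \<inter> A \<times> A = {}"
    using tf sym unfolding triangle_free_def A_def by blast
  have EV: "?E \<subseteq> (A \<union> B) \<times> (A \<union> B)"
    unfolding part(1)[symmetric] by (auto dest: adj_in_verts)
  have finE: "finite (?E \<inter> R)" for R using finite_arcs_ends by simp
  have "?E \<inter> A \<times> B = (\<lambda>(x, y). (y, x)) ` (?E \<inter> B \<times> A)"
    by (auto intro: sym simp: image_iff)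
  then have flip: "card (?E \<inter> A \<times> B) = card (?E \<inter> B \<times> A)"
    using card_image[of "\<lambda>(x, y). (y, x)" "?E \<inter> B \<times> A"]
    by (simp add: inj_on_def split_beta prod_eq_iff)
  \<comment> \<open>The pairs starting in \<open>B\<close> are counted twice: by the side on which
    they end, and as the degree sum over \<open>B\<close>.\<close>
  define D where "D = ?E \<inter> B \<times> verts G"
  have "D = (?E \<inter> B \<times> A) \<union> (?E \<inter> B \<times> B)" using part by (auto simp: D_def)
  moreover have "(?E \<inter> B \<times> A) \<inter> (?E \<inter> B \<times> B) = {}" using part by auto
  ultimately have cD: "card D = card (?E \<inter> B \<times> A) + card (?E \<inter> B \<times> B)"
    using finE by (simp add: card_Un_disjoint)
  have "?E = (?E \<inter> A \<times> B) \<union> D" using EV indep part by (auto simp: D_def)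
  moreover have "(?E \<inter> A \<times> B) \<inter> D = {}" using part by (auto simp: D_def)
  ultimately have cE: "card ?E = card (?E \<inter> A \<times> B) + card D"
    using finE by (metis D_def card_Un_disjoint)
  have "D = Sigma B (\<lambda>b. {w. b \<rightarrow> w})" by (auto simp: D_def dest: adj_in_verts)
  then have "card D = (\<Sum>b\<in>B. deg b)"
    using fin finite_neighbours by (simp add: deg_def)
  also have "\<dots> \<le> (\<Sum>b\<in>B. card A)"
    using deg_le part by (intro sum_mono) (auto simp: deg_def A_def)
  finally have D_le: "card D \<le> card A * card B" by (simp add: mult.commute)
  have sum: "card ?E + card (?E \<inter> B \<times> B) = 2 * card D" using cE cD flip by simp
  show ?thesis
  proof (rule that[OF part])
    show "card ?E \<le> 2 * (card A * card B)" using sum D_le by linarith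
    assume tight: "card ?E = 2 * (card A * card B)"
    \<comment> \<open>\<open>sum\<close> and \<open>D_le\<close> bound the pairs of
      \<open>?E\<close> together with those inside \<open>B\<close> by
      \<open>2 * (card A * card B)\<close>, which \<open>?E\<close> alone already attains.\<close>
    then have "card (?E \<inter> B \<times> B) = 0" using sum D_le by linarith
    then have BB: "?E \<inter> B \<times> B = {}" using finE by simp
    have "card (?E \<inter> A \<times> B) = card (A \<times> B)" "card (?E \<inter> B \<times> A) = card (B \<times> A)"
      using tight sum BB cD flip by (simp_all add: card_cartesian_product mult.commute)
    then have "?E \<inter> A \<times> B = A \<times> B" "?E \<inter> B \<times> A = B \<times> A"
      by (intro card_subset_eq; simp add: fin)+
    then show "?E = A \<times> B \<union> B \<times> A" using EV indep BB by blast
  qed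
qed

text \<open>The bipartition bounds the count by a product of part sizes, and the product by a
  quarter-square. Equality makes both bounds sharp: the first makes the bipartition complete, the
  second makes it balanced.\<close>

lemma (in graph) mantel:
  assumes tf: "triangle_free G"
  defines "n \<equiv> card (verts G)"
  shows "card (arcs_ends G) \<le> 2 * (n\<^sup>2 div 4)"
    and "card (arcs_ends G) = 2 * (n\<^sup>2 div 4) \<Longrightarrow> K\<^bsub>(n + 1) div 2, n div 2\<^esub> G"
proof -
  obtain A B where part: "verts G = A \<union> B" "A \<inter> B = {}"
    and le: "card (arcs_ends G) \<le> 2 * (card A * card B)"
    and eq: "card (arcs_ends G) = 2 * (card A * card B) \<Longrightarrow> arcs_ends G = A \<times> B \<union> B \<times> A"
    using triangle_free_bipartition[OF tf] by blast
  have n: "n = card A + card B"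
    using part finite_verts unfolding n_def by (simp add: card_Un_disjoint)
  have AB: "card A * card B \<le> n\<^sup>2 div 4" unfolding n by (rule mult_le_quarter_square)
  show "card (arcs_ends G) \<le> 2 * (n\<^sup>2 div 4)" using le AB by linarith
  assume "card (arcs_ends G) = 2 * (n\<^sup>2 div 4)"
  then have tight: "card A * card B = n\<^sup>2 div 4" and E: "arcs_ends G = A \<times> B \<union> B \<times> A"
    using le AB eq by auto
  show "K\<^bsub>(n + 1) div 2, n div 2\<^esub> G"
  proof (cases "card B \<le> card A")
    case True
    then have "card A = (n + 1) div 2" "card B = n div 2"
      using mult_eq_quarter_squareD[of "card A" "card B"] tight n by auto
    then show ?thesis
      unfolding complete_bipartite_digraph_def using part E graph_axioms by blast
  next
    case False
    then have "card B = (n + 1) div 2" "card A = n div 2"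
      using mult_eq_quarter_squareD[of "card B" "card A"] tight n by (auto simp: ac_simps)
    moreover have "verts G = B \<union> A" "B \<inter> A = {}" "arcs_ends G = B \<times> A \<union> A \<times> B"
      using part E by auto
    ultimately show ?thesis
      unfolding complete_bipartite_digraph_def using graph_axioms by blast
  qed
qed

section \<open>Connectivity and vertex-cuts\<close>

lemma (in graph) connected_iff_reachable:
  "Digraph_Component.connected G \<longleftrightarrow> verts G \<noteq> {} \<and> (\<forall>u\<in>verts G. \<forall>v\<in>verts G. u \<rightarrow>\<^sup>* v)"
  by (simp add: Digraph_Component.connected_def strongly_connected_def
      reachable_mk_symmetric_eq[OF sym_arcs])

text \<open>\<open>X\<close> is the set of vertices reachable from some \<open>u\<close> that fails
  to reach some \<open>v\<close>; an arc leaving \<open>X\<close> would extend reachability.\<close>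

lemma (in graph) not_connectedE:
  assumes "\<not> Digraph_Component.connected G" "verts G \<noteq> {}"
  obtains X Y where "verts G = X \<union> Y" "X \<inter> Y = {}" "X \<noteq> {}" "Y \<noteq> {}"
    "\<And>x y. x \<in> X \<Longrightarrow> y \<in> Y \<Longrightarrow> \<not> x \<rightarrow> y"
proof -
  obtain u v where uv: "u \<in> verts G" "v \<in> verts G" "\<not> u \<rightarrow>\<^sup>* v"
    using assms by (auto simp: connected_iff_reachable)
  define X where "X = {w. u \<rightarrow>\<^sup>* w}"
  show ?thesis
  proof (rule that[of X "verts G - X"])
    show "verts G = X \<union> (verts G - X)" by (auto simp: X_def reachable_in_verts)
    show "\<not> x \<rightarrow> y" if "x \<in> X" "y \<in> verts G - X" for x y
      using that by (auto simp: X_def dest: reachable_adj_trans)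
  qed (use uv in \<open>auto simp: X_def\<close>)
qed

text \<open>Deleting everything except two non-adjacent vertices disconnects the graph. Hence the
  \<open>Min\<close> in \<open>vertex_connectivity\<close> ranges over a non-empty set.\<close>

lemma (in graph) ex_vertex_cut:
  assumes nc: "\<not> K\<^bsub>card (verts G)\<^esub> G"
  shows "\<exists>S. vertex_cut G S"
proof -
  have "arcs_ends G \<noteq> {(u, v). (u, v) \<in> verts G \<times> verts G \<and> u \<noteq> v}"
    using nc graph_axioms by (auto simp: complete_digraph_def)
  then obtain u v where uv: "u \<in> verts G" "v \<in> verts G" "u \<noteq> v" "\<not> u \<rightarrow> v"
    by (auto dest: adj_in_verts adj_not_same)
  let ?S = "verts G - {u, v}" and ?H = "G \<restriction> {u, v}"
  interpret H: graph ?H using uv by (intro graph_induce_subgraph) auto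
  have "\<not> v \<rightarrow> u" using uv graph_symmetric by blast
  then have "arcs_ends ?H = {}"
    using uv by (auto simp: arcs_ends_induce_subgraph dest: adj_not_same)
  then have "\<not> u \<rightarrow>\<^sup>*\<^bsub>?H\<^esub> v" using uv by (simp add: H.reachable_conv)
  then have "\<not> Digraph_Component.connected ?H" by (auto simp: H.connected_iff_reachable)
  moreover have "verts G - ?S = {u, v}" using uv by auto
  ultimately have "vertex_cut G ?S" using uv by (auto simp: vertex_cut_def)
  then show ?thesis ..
qed

lemma (in graph) ex_min_vertex_cut:
  assumes nc: "\<not> K\<^bsub>card (verts G)\<^esub> G"
  shows "\<exists>S. min_vertex_cut G S"
proof -
  let ?C = "{S. vertex_cut G S}"
  have "?C \<subseteq> Pow (verts G)" by (auto simp: vertex_cut_def)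
  then have "finite ?C" by (rule finite_subset) simp
  then have "Min (card ` ?C) \<in> card ` ?C" using ex_vertex_cut[OF nc] by (intro Min_in) auto
  then show ?thesis using nc by (auto simp: min_vertex_cut_def vertex_connectivity_def)
qed

section \<open>Consequences of the minimum degree\<close>

lemma (in graph) min_degree_le:
  assumes "v \<in> verts G"
  shows "min_degree G \<le> card {w. v \<rightarrow> w}"
  unfolding min_degree_def out_degree_eq_card_neighbours[symmetric]
  using assms by (intro Min_le) auto

text \<open>Rules out the complete-graph branch of \<open>vertex_connectivity\<close>: two
  neighbours of one vertex would be adjacent.\<close>

lemma (in graph) triangle_free_not_complete:
  assumes tf: "triangle_free G" and ne: "verts G \<noteq> {}" and deg: "2 \<le> min_degree G"
  shows "\<not> K\<^bsub>l\<^esub> G"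
proof
  assume "K\<^bsub>l\<^esub> G"
  then have E: "u \<rightarrow> v" if "u \<in> verts G" "v \<in> verts G" "u \<noteq> v" for u v
    using that by (auto simp: complete_digraph_def)
  obtain v where v: "v \<in> verts G" using ne by auto
  have "2 \<le> card {w. v \<rightarrow> w}" using min_degree_le[OF v] deg by linarith
  then obtain a b where ab: "v \<rightarrow> a" "v \<rightarrow> b" "a \<noteq> b"
    by (auto simp: numeral_2_eq_2 card_le_Suc_iff)
  then have "a \<rightarrow> b" using E adj_in_verts by blast
  then show False using tf ab graph_symmetric unfolding triangle_free_def by blast
qed

text \<open>
  As \<open>S\<close> is smaller than the degree of a vertex of \<open>X\<close>, there are two adjacent vertices
  in \<open>X\<close>; their neighbourhoods are disjoint.
\<close>
lemma (in graph) card_side_ge: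
  assumes tf: "triangle_free G" and XS: "X \<union> S \<subseteq> verts G" "X \<noteq> {}"
    and small: "card S < min_degree G"
    and closed: "\<And>x w. x \<in> X \<Longrightarrow> x \<rightarrow> w \<Longrightarrow> w \<in> X \<union> S"
  shows "2 * min_degree G \<le> card (X \<union> S)"
proof -
  obtain x where x: "x \<in> X" using XS by auto
  have fin: "finite (X \<union> S)" using XS finite_subset finite_verts by blast
  have dx: "min_degree G \<le> card {w. x \<rightarrow> w}" using x XS by (intro min_degree_le) auto
  have "\<not> {w. x \<rightarrow> w} \<subseteq> S"
    using card_mono[of S "{w. x \<rightarrow> w}"] fin dx small by auto
  then obtain y where y: "x \<rightarrow> y" "y \<in> X" using closed[OF x] by auto
  have dy: "min_degree G \<le> card {w. y \<rightarrow> w}" using y XS by (intro min_degree_le) auto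
  have "{w. x \<rightarrow> w} \<inter> {w. y \<rightarrow> w} = {}"
    using tf y graph_symmetric unfolding triangle_free_def by blast
  then have "card {w. x \<rightarrow> w} + card {w. y \<rightarrow> w} = card ({w. x \<rightarrow> w} \<union> {w. y \<rightarrow> w})"
    by (simp add: card_Un_disjoint finite_neighbours)
  also have "\<dots> \<le> card (X \<union> S)"
    using closed x y by (intro card_mono fin) blast
  finally show ?thesis using dx dy by linarith
qed

section \<open>Real rounding as natural division\<close>

lemma floor_quarter_square: "\<lfloor>(1 / 4) * (real N)\<^sup>2\<rfloor> = int (N\<^sup>2 div 4)"
  using floor_divide_of_nat_eq[of "N\<^sup>2" 4, where 'a = real] by simp

lemma nat_floor_half: "nat \<lfloor>real N / 2\<rfloor> = N div 2"
  using floor_divide_of_nat_eq[of N 2, where 'a = real] by simp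

lemma nat_ceiling_half: "nat \<lceil>real N / 2\<rceil> = (N + 1) div 2"
proof -
  have "\<lceil>real N / 2\<rceil> = int ((N + 1) div 2)"
    by (rule ceiling_unique) linarith+
  then show ?thesis by simp
qed

section \<open>Small vertex-cuts and the extremal graphs\<close>

theorem theorem5p2:
  fixes G :: "('a, 'b) pre_digraph" and n m \<delta> \<kappa> k :: nat
  assumes "graph G"
    and "Digraph_Component.connected G"
    and "triangle_free G"
    and "n = card (verts G)"
    and "m = graph_size G"
    and "\<delta> = min_degree G"
    and "\<kappa> = vertex_connectivity G"
    and "\<delta> \<ge> k" and "k \<ge> 2"
    and "int m \<ge> (int \<delta>)\<^sup>2 + \<lfloor>(1 / 4) * (real n - 2 * real \<delta> + real k - 1)\<^sup>2\<rfloor>"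
  shows "\<kappa> \<ge> k \<or>
    (\<exists>X S Y. verts G = X \<union> S \<union> Y \<and> X \<inter> S = {} \<and> X \<inter> Y = {} \<and> S \<inter> Y = {}
      \<and> min_vertex_cut G S
      \<and> edgeless_graph (k - 1) (G \<restriction> S)
      \<and> K\<^bsub>\<delta>,\<delta>\<^esub> (G \<restriction> (X \<union> S))
      \<and> K\<^bsub>nat \<lceil>(real n - 2 * real \<delta> + real k - 1) / 2\<rceil>,nat \<lfloor>(real n - 2 * real \<delta> + real k - 1) / 2\<rfloor>\<^esub>
          (G \<restriction> (Y \<union> S)))"
proof (rule disj_imp[THEN iffD2], rule impI)
  assume "\<not> k \<le> \<kappa>"
  then have \<kappa>: "\<kappa> \<le> k - 1" using \<open>k \<ge> 2\<close> by simp
  interpret graph G by fact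
  note tf = \<open>triangle_free G\<close>
  have "verts G \<noteq> {}" using assms(2) by (simp add: connected_iff_reachable)
  then have "\<not> K\<^bsub>card (verts G)\<^esub> G"
    using triangle_free_not_complete[OF tf] assms(6,8,9) by simp
  then obtain S where S: "min_vertex_cut G S" using ex_min_vertex_cut by blast
  then have SV: "S \<subset> verts G" and cS: "card S = \<kappa>"
    and disc: "\<not> Digraph_Component.connected (G \<restriction> (verts G - S))"
    by (auto simp: min_vertex_cut_def vertex_cut_def assms(7))
  let ?H = "G \<restriction> (verts G - S)"
  have "graph ?H" by (intro graph_induce_subgraph) auto
  \<comment> \<open>As \<open>S\<close> is a proper subset, the remaining graph has a vertex, so its
    failure to be connected gives a genuine split.\<close>
  then obtain X Y where XY: "verts G - S = X \<union> Y" "X \<inter> Y = {}" "X \<noteq> {}" "Y \<noteq> {}"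
    and sep: "\<And>x y. x \<in> X \<Longrightarrow> y \<in> Y \<Longrightarrow> \<not> x \<rightarrow>\<^bsub>?H\<^esub> y"
    using graph.not_connectedE[OF _ disc] SV by (metis Diff_eq_empty_iff induce_subgraph_verts psubsetE)
  have V: "verts G = X \<union> S \<union> Y" and disj: "X \<inter> S = {}" "X \<inter> Y = {}" "S \<inter> Y = {}"
    using XY SV by auto
  have noXY: "\<not> x \<rightarrow>\<^bsub>G\<^esub> y" "\<not> y \<rightarrow>\<^bsub>G\<^esub> x" if "x \<in> X" "y \<in> Y" for x y
    using sep[OF that] that XY(1) graph_symmetric by (auto simp: arcs_ends_induce_subgraph)
  have finX: "finite X" and finS: "finite S" and finY: "finite Y"
    using finite_verts unfolding V by auto
  define P where "P = X \<union> S"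
  define Q where "Q = Y \<union> S"
  have sub: "P \<subseteq> verts G" "Q \<subseteq> verts G" using V by (auto simp: P_def Q_def)
  have small: "card S < min_degree G" using cS \<kappa> assms(6,8,9) by simp
  have P: "2 * \<delta> \<le> card P"
    unfolding P_def assms(6)
  proof (rule card_side_ge[OF tf _ XY(3) small])
    show "w \<in> X \<union> S" if "x \<in> X" "x \<rightarrow>\<^bsub>G\<^esub> w" for x w
      using noXY(1)[OF that(1), of w] adj_in_verts(2)[OF that(2)] that(2) V by auto
  qed (use V in auto)
  have Q: "2 * \<delta> \<le> card Q"
    unfolding Q_def assms(6)
  proof (rule card_side_ge[OF tf _ XY(4) small])
    show "w \<in> Y \<union> S" if "y \<in> Y" "y \<rightarrow>\<^bsub>G\<^esub> w" for y w
      using noXY(2)[of w, OF _ that(1)] adj_in_verts(2)[OF that(2)] that(2) V by auto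
  qed (use V in auto)
  have "P \<union> Q = verts G" "P \<inter> Q = S" using V disj by (auto simp: P_def Q_def)
  then have PQ: "card P + card Q = n + card S"
    unfolding assms(4) using card_Un_Int[of P Q] finX finS finY by (simp add: P_def Q_def)
  \<comment> \<open>The expression squared in the hypothesis, as a natural number. The subtraction
    does not truncate, since \<open>P\<close> shows \<open>2 * \<delta> \<le> n\<close>.\<close>
  define N where "N = n + k - 1 - 2 * \<delta>"
  have "2 * \<delta> \<le> n" using P card_mono[OF finite_verts sub(1)] assms(4) by linarith
  then have N: "real n - 2 * real \<delta> + real k - 1 = real N" and N': "N + 2 * \<delta> = n + (k - 1)"
    using \<open>k \<ge> 2\<close> by (auto simp: N_def)
  have "int m \<ge> int (\<delta>\<^sup>2 + N\<^sup>2 div 4)"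
    using assms(10) unfolding N floor_quarter_square by simp
  then have m: "\<delta>\<^sup>2 + N\<^sup>2 div 4 \<le> m" by (simp only: of_nat_le_iff)

  let ?E = "arcs_ends G"
  have "?E \<subseteq> verts G \<times> verts G" by (auto dest: adj_in_verts)
  \<comment> \<open>No arc joins \<open>X\<close> to \<open>Y\<close>, so every arc lies inside
    \<open>P\<close> or inside \<open>Q\<close>; exactly those inside \<open>S\<close> lie in
    both.\<close>
  then have "?E = (?E \<inter> P \<times> P) \<union> (?E \<inter> Q \<times> Q)"
    using noXY unfolding V P_def Q_def by blast
  moreover have "?E \<inter> S \<times> S = (?E \<inter> P \<times> P) \<inter> (?E \<inter> Q \<times> Q)"
    using disj by (auto simp: P_def Q_def)
  ultimately have cE: "card ?E + card (?E \<inter> S \<times> S) = card (?E \<inter> P \<times> P) + card (?E \<inter> Q \<times> Q)"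
    using card_Un_Int[of "?E \<inter> P \<times> P" "?E \<inter> Q \<times> Q"] finite_arcs_ends by simp
  have gP: "graph (G \<restriction> P)" and gQ: "graph (G \<restriction> Q)" and gS: "graph (G \<restriction> S)"
    using sub SV by (auto intro: graph_induce_subgraph)
  note mP = graph.mantel[OF gP triangle_free_induce_subgraph[OF tf],
      unfolded arcs_ends_induce_subgraph induce_subgraph_verts]
  note mQ = graph.mantel[OF gQ triangle_free_induce_subgraph[OF tf],
      unfolded arcs_ends_induce_subgraph induce_subgraph_verts]
  have \<delta>: "0 < \<delta>" using assms(8,9) by simp
  have ab: "card P + card Q \<le> N + 2 * \<delta>" using PQ N' cS \<kappa> by simp
  note conv = quarter_square_convex[OF \<delta> P Q ab]
  have E: "card ?E = 2 * m" using card_arcs_ends assms(5) by simp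
  \<comment> \<open>The chain \<open>2 * m = card ?E\<close>, at most the sum of the counts in
    \<open>P\<close> and \<open>Q\<close>, at most the two Mantel bounds, at most
    \<open>2 * (\<delta>\<^sup>2 + N\<^sup>2 div 4)\<close>, closes up by \<open>m\<close>. Every
    inequality in it is an equality.\<close>
  have tight: "(card P)\<^sup>2 div 4 + (card Q)\<^sup>2 div 4 = \<delta>\<^sup>2 + N\<^sup>2 div 4"
    and E0: "card (?E \<inter> S \<times> S) = 0"
    and eP: "card (?E \<inter> P \<times> P) = 2 * ((card P)\<^sup>2 div 4)"
    and eQ: "card (?E \<inter> Q \<times> Q) = 2 * ((card Q)\<^sup>2 div 4)"
    using m E cE mP(1) mQ(1) conv(1) by linarith+
  from conv(2)[OF tight] have sum: "card P + card Q = N + 2 * \<delta>"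
    and alt: "card P = 2 * \<delta> \<or> card Q = 2 * \<delta>" by auto
  have "card S = k - 1" using sum PQ N' by simp
  moreover have "arcs (G \<restriction> S) = {}"
    using E0 finite_arcs_ends by (auto simp: arcs_ends_conv)
  ultimately have S_edgeless: "edgeless_graph (k - 1) (G \<restriction> S)"
    using gS by (simp add: edgeless_graph_def)
  have KP: "K\<^bsub>(card P + 1) div 2, card P div 2\<^esub> (G \<restriction> P)" by (rule mP(2)[OF eP])
  have KQ: "K\<^bsub>(card Q + 1) div 2, card Q div 2\<^esub> (G \<restriction> Q)" by (rule mQ(2)[OF eQ])
  show "\<exists>X S Y. verts G = X \<union> S \<union> Y \<and> X \<inter> S = {} \<and> X \<inter> Y = {} \<and> S \<inter> Y = {}
      \<and> min_vertex_cut G S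
      \<and> edgeless_graph (k - 1) (G \<restriction> S)
      \<and> K\<^bsub>\<delta>,\<delta>\<^esub> (G \<restriction> (X \<union> S))
      \<and> K\<^bsub>nat \<lceil>(real n - 2 * real \<delta> + real k - 1) / 2\<rceil>,nat \<lfloor>(real n - 2 * real \<delta> + real k - 1) / 2\<rfloor>\<^esub>
          (G \<restriction> (Y \<union> S))"
    \<comment> \<open>Either side may be the one with \<open>2 * \<delta>\<close> vertices; in the
      second case \<open>X\<close> and \<open>Y\<close> exchange roles in the witnesses.\<close>
    using alt
  proof
    assume a: "card P = 2 * \<delta>"
    then have "card Q = N" using sum by simp
    then have "K\<^bsub>\<delta>,\<delta>\<^esub> (G \<restriction> (X \<union> S))" "K\<^bsub>(N + 1) div 2,N div 2\<^esub> (G \<restriction> (Y \<union> S))"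
      using KP KQ a by (simp_all add: P_def Q_def)
    then show ?thesis
      unfolding N nat_floor_half nat_ceiling_half using V disj S S_edgeless
      by - (rule exI[where x = X], rule exI[where x = S], rule exI[where x = Y], intro conjI)
  next
    assume b: "card Q = 2 * \<delta>"
    then have "card P = N" using sum by simp
    then have "K\<^bsub>\<delta>,\<delta>\<^esub> (G \<restriction> (Y \<union> S))" "K\<^bsub>(N + 1) div 2,N div 2\<^esub> (G \<restriction> (X \<union> S))"
      using KP KQ b by (simp_all add: P_def Q_def)
    moreover have "verts G = Y \<union> S \<union> X" "Y \<inter> S = {}" "Y \<inter> X = {}" "S \<inter> X = {}"
      using V disj by auto
    ultimately show ?thesis
      unfolding N nat_floor_half nat_ceiling_half using S S_edgeless
      by - (rule exI[where x = Y], rule exI[where x = S], rule exI[where x = X], intro conjI)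
  qed
qed

end
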